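(* Let $D=(V,E)$ be a finite strongly biconnected digraph without loops, let $s,t\in V$ with $s\neq t$, and let $f:V\to\{\text{robot},\text{obstacle},\text{hole}\}$ be a configuration with the robot at $s$ and at no other vertex. Then the robot can be moved from $s$ to $t$ by a finite sequence of moves if and only if $f(v)=\text{hole}$ for at least one vertex $v\in V$.
   Context: A digraph is strongly biconnected if it is strongly connected and its underlying undirected graph (edges $\{v,w\}$ for arcs $(v,w)$) is biconnected, i.e. connected without a cut vertex. A move consists of choosing an arc $(v,w)\in E$ such that $v$ holds an object (the robot or an obstacle) and $w$ holds a hole, and moving the object from $v$ to $w$ (so $v$ becomes a hole). *)

theory Defs
  imports "Graph_Theory.Graph_Theory"
begin

text \<open>
  An undirected graph is represented, as usual in \<^theory>\<open>Graph_Theory.Digraph\<close>, by a symmetric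
  digraph; \<^const>\<open>mk_symmetric\<close> yields the underlying undirected graph of a digraph.
  The next two definitions are meant for symmetric digraphs.

  A cut vertex separates two other vertices that lie in the same connected component. Phrasing it
  this way avoids asking whether the null graph is connected, which matters when \<open>G\<close> consists of
  a single vertex (\<^const>\<open>connected\<close> is false for the null graph).
\<close>

definition cut_vertex :: "('a, 'b) pre_digraph \<Rightarrow> 'a \<Rightarrow> bool" where
  "cut_vertex G v \<longleftrightarrow> v \<in> verts G \<and>
     (\<exists>x \<in> verts G - {v}. \<exists>y \<in> verts G - {v}.
        x \<rightarrow>\<^sup>*\<^bsub>G\<^esub> y \<and> \<not> x \<rightarrow>\<^sup>*\<^bsub>pre_digraph.del_vert G v\<^esub> y)"

definition biconnected :: "('a, 'b) pre_digraph \<Rightarrow> bool" where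
  "biconnected G \<longleftrightarrow> connected G \<and> \<not> (\<exists>v. cut_vertex G v)"

definition strongly_biconnected :: "('a, 'b) pre_digraph \<Rightarrow> bool" where
  "strongly_biconnected G \<longleftrightarrow>
     strongly_connected G \<and> biconnected (with_proj (mk_symmetric G))"

datatype content = Robot | Obstacle | Hole

text \<open>
  Configurations are total functions on the vertex type; their values outside the vertex set are
  irrelevant, since moves only read and change the contents of vertices of the digraph.
\<close>

definition move :: "'v pair_pre_digraph \<Rightarrow> ('v \<Rightarrow> content) \<Rightarrow> ('v \<Rightarrow> content) \<Rightarrow> bool" where
  "move D g h \<longleftrightarrow>
     (\<exists>v w. (v, w) \<in> parcs D \<and> g v \<noteq> Hole \<and> g w = Hole \<and> h = g(w := g v, v := Hole))"

definition robot_can_reach :: "'v pair_pre_digraph \<Rightarrow> ('v \<Rightarrow> content) \<Rightarrow> 'v \<Rightarrow> bool" where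
  "robot_can_reach D f t \<longleftrightarrow> (\<exists>g. (move D)\<^sup>*\<^sup>* f g \<and> g t = Robot)"

end

theory Submission
  imports Defs "HOL-Combinatorics.Cycles"
begin

text \<open>
  In a strongly connected digraph every move is reversible: close the arc of the move to a directed
  closed walk and let the hole run backwards around it. One round permutes the contents, and since
  permutations have finite order, repeating the round finally restores the original configuration.
  Hence moves may also be made against the arcs, and it suffices to treat the underlying undirected
  graph. There the robot follows a path to its goal; before each step the hole is brought to
  the next vertex while avoiding the robot, whose position is not a cut vertex.
\<close>

text \<open>As precomposition with transpositions, sequences of moves become products of
  permutations. If \<open>a\<close> holds a hole as well, the swap changes nothing, so holes met on
  the way need no special treatment.\<close>

lemma move_transpose:
  assumes "(a, b) \<in> parcs D" "g b = Hole"
  shows "(move D)\<^sup>*\<^sup>* g (g \<circ> Transposition.transpose a b)"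
proof (cases "g a = Hole")
  case True
  then have "g \<circ> Transposition.transpose a b = g"
    using assms by (auto simp: fun_eq_iff Transposition.transpose_def)
  then show ?thesis by simp
next
  case False
  then have "g \<circ> Transposition.transpose a b = g(b := g a, a := Hole)"
    using assms by (auto simp: fun_eq_iff Transposition.transpose_def)
  then have "move D g (g \<circ> Transposition.transpose a b)"
    using assms False unfolding move_def by blast
  then show ?thesis by blast
qed

lemma moveE_transpose:
  assumes "move D g h"
  obtains a b where "(a, b) \<in> parcs D" "g b = Hole" "h = g \<circ> Transposition.transpose a b"
proof -
  from assms obtain a b where "(a, b) \<in> parcs D" "g a \<noteq> Hole" "g b = Hole"
    and h: "h = g(b := g a, a := Hole)"
    unfolding move_def by blast
  moreover from this have "h = g \<circ> Transposition.transpose a b"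
    by (auto simp: fun_eq_iff Transposition.transpose_def)
  ultimately show ?thesis using that by blast
qed

text \<open>The hole starts at \<open>v\<close> and runs against the arcs to \<open>u\<close>. What
  matters is that \<open>p\<close> depends only on the walk and not on \<open>g\<close>: the same
  permutation then describes every further round.\<close>

lemma hole_walk_permutation:
  assumes "(u, v) \<in> (parcs D)\<^sup>*"
  obtains p where "permutation p" "p u = v"
    "\<And>g. g v = Hole \<Longrightarrow> (move D)\<^sup>*\<^sup>* g (g \<circ> p)"
proof -
  have "\<exists>p. permutation p \<and> p u = v \<and> (\<forall>g. g v = Hole \<longrightarrow> (move D)\<^sup>*\<^sup>* g (g \<circ> p))"
    using assms
  proof (induction rule: converse_rtrancl_induct)
    case base
    show ?case by (rule exI[of _ id]) simp
  next
    case (step x y)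
    then obtain p where p: "permutation p" "p y = v"
      and moves: "\<And>g. g v = Hole \<Longrightarrow> (move D)\<^sup>*\<^sup>* g (g \<circ> p)"
      by blast
    let ?q = "p \<circ> Transposition.transpose x y"
    have "(move D)\<^sup>*\<^sup>* g (g \<circ> ?q)" if "g v = Hole" for g
    proof -
      have "(move D)\<^sup>*\<^sup>* (g \<circ> p) (g \<circ> p \<circ> Transposition.transpose x y)"
        using step.hyps(1) p(2) that by (intro move_transpose) simp_all
      with moves[of g] that show ?thesis by (simp add: comp_assoc)
    qed
    moreover have "permutation ?q" "?q x = v"
      using p by (simp_all add: permutation_compose permutation_swap_id)
    ultimately show ?case by blast
  qed
  then show ?thesis using that by blast
qed

lemma move_reversible:
  assumes closed: "\<And>u v. (u, v) \<in> parcs D \<Longrightarrow> (v, u) \<in> (parcs D)\<^sup>*"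
    and "move D g h"
  shows "(move D)\<^sup>*\<^sup>* h g"
proof -
  from \<open>move D g h\<close> obtain a b where ab: "(a, b) \<in> parcs D" "g b = Hole"
    and h: "h = g \<circ> Transposition.transpose a b"
    by (rule moveE_transpose)
  from closed[OF ab(1)] obtain p where p: "permutation p" "p b = a"
    and moves: "\<And>g. g a = Hole \<Longrightarrow> (move D)\<^sup>*\<^sup>* g (g \<circ> p)"
    by (rule hole_walk_permutation) blast
  \<comment> \<open>The effect of one round: the arc from \<open>a\<close> to \<open>b\<close> takes
    the hole from \<open>b\<close> to \<open>a\<close>, and \<open>p\<close> brings it back to
    \<open>b\<close>.\<close>
  define r where "r = Transposition.transpose a b \<circ> p"
  have round: "(move D)\<^sup>*\<^sup>* k (k \<circ> r)" if "k b = Hole" for k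
  proof -
    have "(move D)\<^sup>*\<^sup>* (k \<circ> Transposition.transpose a b) (k \<circ> Transposition.transpose a b \<circ> p)"
      using that by (intro moves) simp
    with move_transpose[of a b D k] ab(1) that show ?thesis by (simp add: r_def comp_assoc)
  qed
  \<comment> \<open>The hole is at \<open>b\<close> again after each round, so that the next round
    can start.\<close>
  have rb: "(r ^^ n) b = b" for n
    by (induction n) (simp_all add: r_def p)
  \<comment> \<open>The start is \<open>g \<circ> r\<close> rather than \<open>g\<close>, because
    \<open>h\<close> lies inside the first round and reaches \<open>g \<circ> r\<close> by
    completing it.\<close>
  have rounds: "(move D)\<^sup>*\<^sup>* (g \<circ> r) (g \<circ> r ^^ Suc n)" for n
  proof (induction n)
    case 0
    show ?case by simp
  next
    case (Suc n)
    have "(move D)\<^sup>*\<^sup>* (g \<circ> r ^^ Suc n) (g \<circ> r ^^ Suc n \<circ> r)"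
      by (rule round) (simp only: comp_apply rb ab)
    moreover have "g \<circ> r ^^ Suc n \<circ> r = g \<circ> r ^^ Suc (Suc n)"
      by (simp only: funpow_Suc_right comp_assoc)
    ultimately show ?case using Suc.IH by (metis rtranclp_trans)
  qed
  have "permutation r"
    by (simp add: r_def p permutation_compose permutation_swap_id)
  then obtain n where "r ^^ n = id" "n > 0"
    by (rule permutation_is_nilpotent)
  with rounds[of "n - 1"] have "(move D)\<^sup>*\<^sup>* (g \<circ> r) g" by simp
  moreover have "(move D)\<^sup>*\<^sup>* h (g \<circ> r)"
    using moves[of h] ab by (simp add: h r_def comp_assoc)
  ultimately show ?thesis by simp
qed

lemma moves_reversible:
  assumes "\<And>u v. (u, v) \<in> parcs D \<Longrightarrow> (v, u) \<in> (parcs D)\<^sup>*"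
    and "(move D)\<^sup>*\<^sup>* g h"
  shows "(move D)\<^sup>*\<^sup>* h g"
  using assms(2) by induction (auto intro: rtranclp_trans move_reversible[OF assms(1)])

lemma undirected_move:
  assumes closed: "\<And>u v. (u, v) \<in> parcs D \<Longrightarrow> (v, u) \<in> (parcs D)\<^sup>*"
    and edge: "(a, b) \<in> parcs (mk_symmetric (with_proj D))" and "g b = Hole"
  shows "(move D)\<^sup>*\<^sup>* g (g \<circ> Transposition.transpose a b)"
proof -
  from edge consider "(a, b) \<in> parcs D" | "(b, a) \<in> parcs D"
    by (auto simp: parcs_mk_symmetric)
  then show ?thesis
  proof cases
    case 1
    then show ?thesis using \<open>g b = Hole\<close> by (rule move_transpose)
  next
    case 2
    \<comment> \<open>The hole of \<open>?h\<close> is at \<open>a\<close>, so the arc from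
      \<open>b\<close> to \<open>a\<close> allows the swap from \<open>?h\<close> back to
      \<open>g\<close>; this is then reversed.\<close>
    let ?h = "g \<circ> Transposition.transpose a b"
    have "(move D)\<^sup>*\<^sup>* ?h (?h \<circ> Transposition.transpose b a)"
      using 2 \<open>g b = Hole\<close> by (intro move_transpose) simp_all
    moreover have "?h \<circ> Transposition.transpose b a = g"
      by (simp add: comp_assoc transpose_commute[of b a])
    ultimately show ?thesis
      using moves_reversible[OF closed] by metis
  qed
qed

text \<open>Each swap uses an edge with both ends different from \<open>r\<close>, so the content of
  \<open>r\<close>, later the robot, stays in place. The hole travels from \<open>y\<close> to
  \<open>x\<close>, hence the induction from the far end of the path.\<close>

lemma move_hole_avoiding:
  fixes D :: "'v pair_pre_digraph"
  defines "G \<equiv> with_proj (mk_symmetric (with_proj D))"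
  assumes closed: "\<And>u v. (u, v) \<in> parcs D \<Longrightarrow> (v, u) \<in> (parcs D)\<^sup>*"
    and path: "(x, y) \<in> (arcs_ends (pre_digraph.del_vert G r))\<^sup>*"
    and "g y = Hole"
  obtains h where "(move D)\<^sup>*\<^sup>* g h" "h x = Hole" "h r = g r"
proof -
  from path have "\<exists>h. (move D)\<^sup>*\<^sup>* g h \<and> h x = Hole \<and> h r = g r"
  proof (induction rule: converse_rtrancl_induct)
    case base
    then show ?case using \<open>g y = Hole\<close> by blast
  next
    case (step x z)
    then obtain h where h: "(move D)\<^sup>*\<^sup>* g h" "h z = Hole" "h r = g r" by blast
    from step.hyps(1) have edge: "(x, z) \<in> parcs (mk_symmetric (with_proj D))" and "x \<noteq> r" "z \<noteq> r"
      by (auto simp: G_def arcs_ends_conv pre_digraph.del_vert_def)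
    let ?k = "h \<circ> Transposition.transpose x z"
    have "(move D)\<^sup>*\<^sup>* h ?k"
      using closed edge h(2) by (rule undirected_move)
    with h(1) have "(move D)\<^sup>*\<^sup>* g ?k" by (rule rtranclp_trans)
    moreover have "?k x = Hole" "?k r = g r"
      using h \<open>x \<noteq> r\<close> \<open>z \<noteq> r\<close> by simp_all
    ultimately show ?case by blast
  qed
  then show ?thesis using that by blast
qed

lemma move_robot:
  fixes D :: "'v pair_pre_digraph"
  defines "G \<equiv> with_proj (mk_symmetric (with_proj D))"
  assumes "pair_digraph D" "strongly_biconnected (with_proj D)"
    and "s \<in> pverts D" "t \<in> pverts D" "f s = Robot" "u \<in> pverts D" "f u = Hole"
  shows "robot_can_reach D f t"
proof -
  interpret D: pair_digraph D by fact
  interpret G: pair_digraph "mk_symmetric (with_proj D)"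
    by (rule D.digraph_mk_symmetric)
  have strong: "strongly_connected (with_proj D)" and no_cut: "\<not> cut_vertex G v" for v
    using assms(3) by (auto simp: strongly_biconnected_def biconnected_def G_def)
  have verts: "verts G = pverts D" by (simp add: G_def)
  have D_reach: "v \<rightarrow>\<^sup>*\<^bsub>with_proj D\<^esub> w" if "v \<in> pverts D" "w \<in> pverts D" for v w
    using strong that by (auto simp: strongly_connected_def)
  \<comment> \<open>Strong connectivity puts every arc on a directed closed walk, as reversibility
    requires.\<close>
  have closed: "(w, v) \<in> (parcs D)\<^sup>*" if "(v, w) \<in> parcs D" for v w
    using reachable_rtranclI[OF D_reach[of w v]] D.in_arcsD1[OF that] D.in_arcsD2[OF that] by simp
  have G_reach: "v \<rightarrow>\<^sup>*\<^bsub>G\<^esub> w" if "v \<in> pverts D" "w \<in> pverts D" for v w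
    unfolding G_def using D.reachable_mk_symmetricI[OF D_reach[OF that]] .
  have "s \<rightarrow>\<^sup>*\<^bsub>G\<^esub> t" by (rule G_reach) fact+
  then have "(s, t) \<in> (arcs_ends G)\<^sup>*" by (rule reachable_rtranclI)
  \<comment> \<open>The invariant also records a hole, since the next step of the robot needs
    one.\<close>
  then have "\<exists>g. (move D)\<^sup>*\<^sup>* f g \<and> g t = Robot \<and> (\<exists>y \<in> pverts D. g y = Hole)"
  proof (induction rule: rtrancl_induct)
    case base
    then show ?case using assms by blast
  next
    case (step b c)
    then obtain g y where g: "(move D)\<^sup>*\<^sup>* f g" "g b = Robot" "y \<in> pverts D" "g y = Hole"
      by blast
    from step.hyps(2) have edge: "(b, c) \<in> parcs (mk_symmetric (with_proj D))"
      by (simp add: G_def)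
    then have bc: "b \<noteq> c" "b \<in> pverts D" "c \<in> pverts D"
      using G.pair_no_loops G.in_arcsD1 G.in_arcsD2 by fastforce+
    \<comment> \<open>Both \<open>c\<close> and \<open>y\<close> thus differ from the robot's
      position \<open>b\<close>, which does not separate them.\<close>
    have "y \<noteq> b" using g by auto
    then have "c \<rightarrow>\<^sup>*\<^bsub>pre_digraph.del_vert G b\<^esub> y"
      using no_cut[of b] bc g(3) G_reach[of c y] by (auto simp: cut_vertex_def verts)
    then have "(c, y) \<in> (arcs_ends (pre_digraph.del_vert G b))\<^sup>*"
      by (rule reachable_rtranclI)
    with closed g(4) obtain h
      where h: "(move D)\<^sup>*\<^sup>* g h" "h c = Hole" "h b = g b"
      unfolding G_def using move_hole_avoiding[of D c y b g] by blast
    let ?k = "h \<circ> Transposition.transpose b c"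
    have "(move D)\<^sup>*\<^sup>* h ?k" using closed edge h(2) by (rule undirected_move)
    with g(1) h(1) have "(move D)\<^sup>*\<^sup>* f ?k" by simp
    \<comment> \<open>The vertex just left by the robot supplies the hole for the next step.\<close>
    moreover have "?k c = Robot" "?k b = Hole" using h g by auto
    ultimately show ?case using bc(2) by blast
  qed
  then show ?thesis unfolding robot_can_reach_def by blast
qed

theorem theorem9:
  fixes D :: "'v pair_pre_digraph" and s t :: 'v and f :: "'v \<Rightarrow> content"
  assumes "pair_digraph D"
    and "strongly_biconnected (with_proj D)"
    and "s \<in> pverts D" and "t \<in> pverts D" and "s \<noteq> t"
    and "f s = Robot" and "\<forall>v \<in> pverts D. v \<noteq> s \<longrightarrow> f v \<noteq> Robot"
  shows "robot_can_reach D f t \<longleftrightarrow> (\<exists>v \<in> pverts D. f v = Hole)"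
proof
  assume "\<exists>v \<in> pverts D. f v = Hole"
  then show "robot_can_reach D f t"
    using assms by (blast intro: move_robot)
next
  interpret D: pair_digraph D by fact
  assume "robot_can_reach D f t"
  then obtain g where "(move D)\<^sup>*\<^sup>* f g" "g t = Robot"
    unfolding robot_can_reach_def by blast
  \<comment> \<open>So at least one move is made, and the first one already needs a hole in
    \<open>f\<close>.\<close>
  moreover have "f t \<noteq> Robot" using assms(4,5,7) by auto
  ultimately obtain h where "move D f h"
    by (metis converse_rtranclpE)
  then show "\<exists>v \<in> pverts D. f v = Hole"
    unfolding move_def using D.in_arcsD2 by blast
qed

end
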